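(* Let $S$ be a left legal semigroup. The following two conditions on $S$ are equivalent. (i) $S$ is right separative. (ii) $S$ is weakly separative.
   Context: A semigroup is left legal if it satisfies the identity $aba=ab$. A semigroup $S$ is right separative if, for all $a,b\in S$, $ab=b^2$ and $ba=a^2$ together imply $a=b$. A semigroup $S$ is weakly separative if, for all $a,b\in S$, $a^2=ab=b^2$ implies $a=b$. *)

theory Defs
  imports Main
begin

text \<open>
  A semigroup is given by its operation \<open>f\<close> on the type \<^typ>\<open>'a\<close>, in the sense of the library
  locale \<^locale>\<open>semigroup\<close>. The properties below are predicates of the operation; associativity
  is a separate assumption.
\<close>

definition left_legal :: "('a \<Rightarrow> 'a \<Rightarrow> 'a) \<Rightarrow> bool" where
  "left_legal f \<longleftrightarrow> (\<forall>a b. f (f a b) a = f a b)"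

definition right_separative :: "('a \<Rightarrow> 'a \<Rightarrow> 'a) \<Rightarrow> bool" where
  "right_separative f \<longleftrightarrow> (\<forall>a b. f a b = f b b \<and> f b a = f a a \<longrightarrow> a = b)"

definition weakly_separative :: "('a \<Rightarrow> 'a \<Rightarrow> 'a) \<Rightarrow> bool" where
  "weakly_separative f \<longleftrightarrow> (\<forall>a b. f a a = f a b \<and> f a b = f b b \<longrightarrow> a = b)"

end

theory Submission
  imports Defs
begin

text \<open>In a left legal semigroup the premises of the two cancellation conditions are
  equivalent: \<open>ab = b^2\<close> with \<open>ba = a^2\<close> holds iff
  \<open>a^2 = ab = b^2\<close>. Both directions expand a product by \<open>xy = xyx\<close>,
  rewrite it to a cube, and collapse that by \<open>x^3 = x^2\<close>, which is legality with equal
  arguments.\<close>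

theorem theorem12:
  fixes f :: "'a \<Rightarrow> 'a \<Rightarrow> 'a"
  assumes "semigroup f"
    and "left_legal f"
  shows "right_separative f \<longleftrightarrow> weakly_separative f"
proof -
  interpret semigroup f by fact
  have legal: "f (f x y) x = f x y" for x y
    using assms(2) unfolding left_legal_def by blast
  have right_imp: "f b a = f a a" if "f a a = f a b" "f a b = f b b" for a b
  proof -
    have "f b a = f b (f a b)" using legal[of b a] by (simp add: assoc)
    \<comment> \<open>Replacing the inner \<open>ab\<close> by \<open>b^2\<close> leaves a cube of
      \<open>b\<close>.\<close>
    also have "\<dots> = f (f b b) b" using that(2) by (metis assoc)
    also have "\<dots> = f a a" using that by (simp add: legal)
    finally show ?thesis .
  qed
  have weak_imp: "f a b = f a a" if "f a b = f b b" "f b a = f a a" for a b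
  proof -
    have "f a b = f (f b b) a" using legal[of a b] that(1) by simp
    \<comment> \<open>Regrouping lets \<open>ba = a^2\<close> act inside:
      \<open>(bb)a = b(ba) = b(aa) = (ba)a\<close>. A second use then gives
      \<open>a^3\<close>.\<close>
    also have "\<dots> = f (f b a) a" using that(2) by (metis assoc)
    also have "\<dots> = f a a" using that(2) by (simp add: legal)
    finally show ?thesis .
  qed
  show ?thesis
    unfolding right_separative_def weakly_separative_def
    using right_imp weak_imp by metis
qed

end
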